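(* Consider a Poisson thinning structural equation model (PT-SEM) on a DAG $G=(V,E)$, $V=\{1,\dots,d\}$, with thinning coefficients $(\alpha_{ij})$ and mutually independent exogenous variables $\varepsilon_1,\dots,\varepsilon_d$ satisfying, for every $i\in V$: (A1) $\Pr(\varepsilon_i=0)>0$; (A2) $\operatorname{Var}(\varepsilon_i)>0$; (A3) $M_{\varepsilon_i}(t)=\mathbb E[e^{t\varepsilon_i}]<\infty$ for $t$ in a neighborhood of zero. Then the observational distribution of $\boldsymbol X=(X_1,\dots,X_d)^\top$ uniquely determines $G$, the thinning coefficient matrix $\boldsymbol A=(\alpha_{ij})_{i,j\in V}$, and the node-wise exogenous distributions. That is, if two PT-SEMs on $V$ (with possibly different DAGs), both satisfying (A1)--(A3), induce the same distribution of $\boldsymbol X$ on $\mathbb N_0^d$, then they have the same DAG, the same matrix $\boldsymbol A$, and, for each $i\in V$, the same distribution of $\varepsilon_i$.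
   Context: $\mathbb N_0=\{0,1,2,\dots\}$. Poisson thinning: for a $\mathbb N_0$-valued random variable $X$ and $\alpha\ge0$, $\alpha\circ_p X=\sum_{\ell=1}^{X}Z_\ell$, where the offspring variables $Z_1,Z_2,\dots$ are i.i.d. $\mathrm{Poisson}(\alpha)$ and independent of $X$ (the empty sum is $0$). PT-SEM associated with a DAG $G=(V,E)$, $V=\{1,\dots,d\}$: $X_i=\sum_{j\in\operatorname{pa}_G(i)}\alpha_{ij}\circ_p X_j+\varepsilon_i$, $i\in V$, where $\operatorname{pa}_G(i)$ is the set of parents of $i$, $\alpha_{ij}>0$ for every edge $j\to i\in E$, the variables $\varepsilon_1,\dots,\varepsilon_d$ are mutually independent $\mathbb N_0$-valued random variables (with arbitrary, possibly different, distributions), and all Poisson offspring variables associated with the terms $\alpha_{ij}\circ_pX_j$ (over all edges) are mutually independent and independent of $\{\varepsilon_i:i\in V\}$. Convention: $\alpha_{ij}=0$ whenever $j\notin\operatorname{pa}_G(i)$, so that $j\to i\in E$ iff $\alpha_{ij}>0$. The observational distribution is the joint distribution of $\boldsymbol X$. *)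

theory Defs
  imports "HOL-Probability.Probability"
begin

text \<open>
  A thinning is a random sum; that the offspring sequence \<open>Z\<close> is i.i.d. Poisson is imposed
  in the locale below.
\<close>

definition thinning :: "(nat \<Rightarrow> 'a \<Rightarrow> nat) \<Rightarrow> ('a \<Rightarrow> nat) \<Rightarrow> 'a \<Rightarrow> nat" where
  "thinning Z X \<omega> = (\<Sum>l=1..X \<omega>. Z l \<omega>)"

definition parents :: "(nat \<times> nat) set \<Rightarrow> nat \<Rightarrow> nat set" where
  "parents E i = {j. (j, i) \<in> E}"

text \<open>
  An edge \<open>j \<rightarrow> i\<close> is the pair \<open>(j, i) \<in> E\<close>, while its coefficient is \<open>\<alpha> i j\<close> and its offspring
  sequence is \<open>Z i j\<close> (child first). The values of \<open>\<alpha>\<close>, \<open>\<epsilon>\<close>, \<open>X\<close> outside the vertex set, and of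
  \<open>Z\<close> outside the edges, are irrelevant. The assumption \<open>indep\<close> says that all exogenous and all
  offspring variables form one mutually independent family, i.e. that the exogenous variables
  are mutually independent, the offspring variables are mutually independent, and these two
  families are independent of each other. Structural equations hold almost surely.
\<close>

locale pt_sem = prob_space M
  for M :: "'a measure"
    and d :: nat
    and E :: "(nat \<times> nat) set"
    and \<alpha> :: "nat \<Rightarrow> nat \<Rightarrow> real"
    and \<epsilon> :: "nat \<Rightarrow> 'a \<Rightarrow> nat"
    and Z :: "nat \<Rightarrow> nat \<Rightarrow> nat \<Rightarrow> 'a \<Rightarrow> nat"
    and X :: "nat \<Rightarrow> 'a \<Rightarrow> nat" +
  assumes edges: "E \<subseteq> {1..d} \<times> {1..d}"
    and dag: "acyclic E"
    and coeff_pos: "\<And>i j. (j, i) \<in> E \<Longrightarrow> \<alpha> i j > 0"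
    and coeff_zero: "\<And>i j. i \<in> {1..d} \<Longrightarrow> j \<in> {1..d} \<Longrightarrow> (j, i) \<notin> E \<Longrightarrow> \<alpha> i j = 0"
    and indep: "indep_vars (\<lambda>_. count_space UNIV)
      (case_sum \<epsilon> (\<lambda>(i, j, l). Z i j l))
      ({1..d} <+> {(i, j, l). (j, i) \<in> E \<and> 1 \<le> l})"
    and offspring: "\<And>i j l. (j, i) \<in> E \<Longrightarrow> 1 \<le> l \<Longrightarrow>
      distr M (count_space UNIV) (Z i j l) = measure_pmf (poisson_pmf (\<alpha> i j))"
    and X_measurable: "\<And>i. i \<in> {1..d} \<Longrightarrow> random_variable (count_space UNIV) (X i)"
    and structural_eq: "\<And>i. i \<in> {1..d} \<Longrightarrow>
      AE \<omega> in M. X i \<omega> = (\<Sum>j\<in>parents E i. thinning (Z i j) (X j) \<omega>) + \<epsilon> i \<omega>"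

locale regular_pt_sem = pt_sem +
  assumes A1: "\<And>i. i \<in> {1..d} \<Longrightarrow> prob {\<omega> \<in> space M. \<epsilon> i \<omega> = 0} > 0"
    and A2: "\<And>i. i \<in> {1..d} \<Longrightarrow> variance (\<lambda>\<omega>. real (\<epsilon> i \<omega>)) > 0"
    and A3: "\<And>i. i \<in> {1..d} \<Longrightarrow>
      \<exists>\<delta>>0. \<forall>t. \<bar>t\<bar> < \<delta> \<longrightarrow> integrable M (\<lambda>\<omega>. exp (t * real (\<epsilon> i \<omega>)))"

definition observational_distribution ::
    "'a measure \<Rightarrow> nat \<Rightarrow> (nat \<Rightarrow> 'a \<Rightarrow> nat) \<Rightarrow> (nat \<Rightarrow> nat) measure" where
  "observational_distribution M d X =
     distr M (\<Pi>\<^sub>M i\<in>{1..d}. count_space UNIV) (\<lambda>\<omega>. \<lambda>i\<in>{1..d}. X i \<omega>)"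

end

theory Submission
  imports Defs
begin

text \<open>
  The structural equations determine the joint law explicitly: \<open>P(X = x)\<close> is the product over the
  nodes \<open>i\<close> of the probability that \<open>\<epsilon> i\<close> plus an independent Poisson variable of rate
  \<open>\<Sum>j. \<alpha> i j * x j\<close> equals \<open>x i\<close>. If a sink \<open>s\<close> of one model had a child \<open>c\<close> in the other, then
  comparing the two products at the points that vanish outside \<open>s\<close> and \<open>c\<close> would factor one
  bivariate law in both causal directions; a few values with coordinates at most 3 show that this
  is impossible. So a sink of one model is a sink of the other; summing it out gives the induction
  on the number of nodes, and the conditional laws of the sink given that the other nodes are
  \<open>0\<close>, or all but one are \<open>0\<close>, identify its noise and its coefficients.
\<close>

section \<open>Convolution with a Poisson law\<close>

text \<open>Convolution with the Poisson weights stripped of \<open>exp (- l)\<close>; what remains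
  is polynomial in \<open>l\<close>, so comparing two models becomes polynomial algebra.\<close>

definition poisson_mix :: "(nat \<Rightarrow> real) \<Rightarrow> real \<Rightarrow> nat \<Rightarrow> real" where
  "poisson_mix p l n = (\<Sum>m\<le>n. p m * (l ^ (n - m) / fact (n - m)))"

definition poisson_conv :: "(nat \<Rightarrow> real) \<Rightarrow> real \<Rightarrow> nat \<Rightarrow> real" where
  "poisson_conv p l n = exp (- l) * poisson_mix p l n"

lemma poisson_mix_0_right [simp]: "poisson_mix p l 0 = p 0"
  by (simp add: poisson_mix_def)

lemma poisson_mix_0_rate [simp]: "poisson_mix p 0 n = p n"
proof -
  have "poisson_mix p 0 n = (\<Sum>m\<le>n. if m = n then p m else 0)"
    unfolding poisson_mix_def by (intro sum.cong) (auto simp: power_0_left)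
  then show ?thesis by simp
qed

lemma poisson_conv_0_right [simp]: "poisson_conv p l 0 = exp (- l) * p 0"
  by (simp add: poisson_conv_def)

lemma poisson_conv_0_rate [simp]: "poisson_conv p 0 n = p n"
  by (simp add: poisson_conv_def)

text \<open>The Poisson weights have the exponential series as generating function, so rates add
  under repeated convolution.\<close>

lemma fps_poisson_mix: "Abs_fps (poisson_mix p l) = Abs_fps p * fps_exp l"
  by (rule fps_ext) (simp add: poisson_mix_def fps_mult_nth atLeast0AtMost)

lemma poisson_mix_add: "poisson_mix (poisson_mix p l) m = poisson_mix p (l + m)"
proof -
  have "Abs_fps (poisson_mix (poisson_mix p l) m) = Abs_fps (poisson_mix p (l + m))"
    by (simp only: fps_poisson_mix fps_exp_add_mult mult.assoc)
  then show ?thesis by (simp add: Abs_fps_inject)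
qed

lemma poisson_conv_add: "poisson_conv (poisson_conv p l) m n = poisson_conv p (l + m) n"
proof -
  have "poisson_conv (poisson_conv p l) m n = exp (- m) * exp (- l) * poisson_mix (poisson_mix p l) m n"
    by (simp add: poisson_conv_def poisson_mix_def sum_distrib_left mult_ac)
  then show ?thesis
    by (simp add: poisson_mix_add poisson_conv_def mult_exp_exp algebra_simps)
qed

lemma poisson_conv_sums:
  assumes p: "p sums 1" "\<And>n. p n \<ge> 0"
  shows "poisson_conv p l sums 1"
proof -
  have 1: "(\<lambda>n. l ^ n / fact n) sums exp l"
    using exp_converges[of l] by (simp add: scaleR_conv_of_real divide_inverse mult.commute)
  have "summable (\<lambda>n. norm (l ^ n / fact n))"
    using summable_norm_exp[of l] by (simp add: scaleR_conv_of_real divide_inverse mult.commute norm_power norm_mult)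
  moreover have "summable (\<lambda>n. norm (p n))"
    using p by (simp add: sums_iff)
  ultimately have "(\<lambda>n. \<Sum>i\<le>n. p i * (l ^ (n - i) / fact (n - i))) sums ((\<Sum>n. p n) * (\<Sum>n. l ^ n / fact n))"
    by (intro Cauchy_product_sums)
  then have "poisson_mix p l sums exp l"
    using p 1 by (simp add: sums_iff poisson_mix_def[abs_def])
  from sums_mult[OF this, of "exp (- l)"] show ?thesis
    by (simp add: poisson_conv_def[abs_def] mult_exp_exp)
qed

section \<open>Bounds and small values of Poisson mixtures\<close>

lemma poisson_mix_ge:
  assumes "\<And>n. p n \<ge> 0" "l \<ge> 0" "m \<le> n"
  shows "poisson_mix p l n \<ge> p m * (l ^ (n - m) / fact (n - m))"
  unfolding poisson_mix_def
  by (rule member_le_sum[of m "{..n}" "\<lambda>m. p m * (l ^ (n - m) / fact (n - m))"]) (use assms in auto)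

lemma poisson_mix_pos:
  assumes "\<And>n. p n \<ge> 0" "p 0 > 0" "l > 0"
  shows "poisson_mix p l n > 0"
proof -
  have "p 0 * (l ^ n / fact n) > 0" using assms by simp
  also have "p 0 * (l ^ n / fact n) \<le> poisson_mix p l n" using poisson_mix_ge[of p l 0 n] assms by simp
  finally show ?thesis .
qed

text \<open>The terms \<open>m = 0\<close> and \<open>m = n\<close> are distinct and the former is
  positive: a positive rate strictly raises every value but the one at 0.\<close>

lemma poisson_mix_gt:
  assumes "\<And>n. p n \<ge> 0" "p 0 > 0" "l > 0" "n > 0"
  shows "poisson_mix p l n > p n"
proof -
  have "p 0 * (l ^ n / fact n) + p n = (\<Sum>m\<in>{0,n}. p m * (l ^ (n - m) / fact (n - m)))"
    using assms by simp
  also have "\<dots> \<le> poisson_mix p l n"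
    unfolding poisson_mix_def by (rule sum_mono2) (use assms in auto)
  finally show ?thesis using assms by (smt (verit) divide_pos_pos fact_gt_zero mult_pos_pos zero_less_power)
qed

lemma poisson_mix_1: "poisson_mix p l 1 = p 0 * l + p 1"
  by (simp add: poisson_mix_def)

lemma poisson_mix_2: "poisson_mix p l 2 = p 0 * l ^ 2 / 2 + p 1 * l + p 2"
proof -
  have "{..2} = {0, 1, 2 :: nat}" by auto
  then show ?thesis by (simp add: poisson_mix_def)
qed

lemma poisson_mix_3: "poisson_mix p l 3 = p 0 * l ^ 3 / 6 + p 1 * l ^ 2 / 2 + p 2 * l + p 3"
proof -
  have "{..3} = {0, 1, 2, 3 :: nat}" by auto
  then show ?thesis by (simp add: poisson_mix_def fact_numeral)
qed

text \<open>With the rate measured in units of \<open>p 1 / p 0\<close>, the first four values of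
  \<open>p\<close> enter only through \<open>t\<close> and \<open>w\<close>, which do not change
  when \<open>p n\<close> is replaced by \<open>c * u ^ n * p n\<close> with positive
  \<open>c\<close> and \<open>u\<close>.\<close>

lemma poisson_mix_normalized:
  fixes p :: "nat \<Rightarrow> real"
  assumes pos: "p 0 > 0" "p 1 > 0" "p 2 > 0" "p 3 > 0"
  defines "t \<equiv> p 1 ^ 2 / (p 0 * p 2)" and "w \<equiv> p 1 ^ 3 / (p 0 ^ 2 * p 3)"
  shows "poisson_mix p (p 1 / p 0 * y) 1 / p 1 = 1 + y"
    and "poisson_mix p (p 1 / p 0 * y) 2 / p 2 = 1 + t * (y + y ^ 2 / 2)"
    and "poisson_mix p (p 1 / p 0 * y) 3 / p 3 = 1 + w * (y / t + y ^ 2 / 2 + y ^ 3 / 6)"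
proof -
  obtain p0 p1 p2 p3 where p: "p 0 = p0" "p 1 = p1" "p 2 = p2" "p 3 = p3" by blast
  note pos = pos[unfolded p]
  have t: "t = p1 ^ 2 / (p0 * p2)" and w: "w = p1 ^ 3 / (p0 ^ 2 * p3)"
    by (simp_all only: t_def w_def p)
  have 1: "p0 * (p1 / p0 * y) = p1 * y" using pos by simp
  have 2: "p0 * (p1 / p0 * y) ^ 2 = t * p2 * y ^ 2"
    using pos by (simp add: t power2_eq_square)
  have 3: "p1 * (p1 / p0 * y) = t * p2 * y"
    using pos by (simp add: t power2_eq_square)
  have 4: "p0 * (p1 / p0 * y) ^ 3 = w * p3 * y ^ 3"
    using pos by (simp add: w power2_eq_square power3_eq_cube)
  have 5: "p1 * (p1 / p0 * y) ^ 2 = w * p3 * y ^ 2"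
    using pos by (simp add: w power2_eq_square power3_eq_cube)
  have 6: "p2 * (p1 / p0 * y) = w * p3 * (y / t)"
    using pos by (simp add: w t power2_eq_square power3_eq_cube)
  show "poisson_mix p (p 1 / p 0 * y) 1 / p 1 = 1 + y"
    unfolding poisson_mix_1 p 1 using pos by (simp add: field_simps)
  show "poisson_mix p (p 1 / p 0 * y) 2 / p 2 = 1 + t * (y + y ^ 2 / 2)"
    unfolding poisson_mix_2 p 2 3 using pos by (simp add: add_divide_distrib algebra_simps)
  show "poisson_mix p (p 1 / p 0 * y) 3 / p 3 = 1 + w * (y / t + y ^ 2 / 2 + y ^ 3 / 6)"
    unfolding poisson_mix_3 p 4 5 6 using pos by (simp add: add_divide_distrib algebra_simps)
qed

text \<open>
  For \<open>a > 0\<close>, normalize by \<open>x = a * p 0 / p 1\<close>. The values at \<open>(1, 1)\<close>, \<open>(2, 1)\<close>, \<open>(1, 2)\<close> force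
  \<open>x = b * q 0 / q 1\<close> and fix the second-order ratios of \<open>p\<close> and \<open>q\<close>; those at \<open>(1, 3)\<close> and \<open>(2, 3)\<close>
  then give \<open>x ^ 3 = 0\<close>.
\<close>

lemma no_two_way_factorization:
  assumes p: "\<And>n. p n \<ge> 0" "p 0 > 0" "\<exists>n>0. p n > 0"
    and q: "\<And>n. q n \<ge> 0" "q 0 > 0" "\<exists>n>0. q n > 0"
    and ab: "a \<ge> 0" "b > 0"
    and eq: "\<And>n k. poisson_mix p (a * real k) n * q k = p n * poisson_mix q (b * real n) k"
  shows False
proof (cases "a = 0")
  case True
  obtain n k where nk: "n > 0" "p n > 0" "k > 0" "q k > 0" using p q by blast
  \<comment> \<open>At \<open>a = 0\<close> the left side of \<open>eq\<close> is
    \<open>p n * q k\<close>, whereas the positive rate \<open>b * real n\<close> strictly raises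
    \<open>q k\<close>.\<close>
  have "poisson_mix q (b * real n) k > q k"
    using nk ab q by (intro poisson_mix_gt) auto
  with eq[where n = n and k = k] nk True show False by simp
next
  case False
  with ab have a: "a > 0" by simp
  obtain n k where nk: "n > 0" "p n > 0" "k > 0" "q k > 0" using p q by blast
  \<comment> \<open>One \<open>k > 0\<close> with \<open>q k > 0\<close> makes the left side of
    \<open>eq\<close> positive for every \<open>m\<close>; so \<open>p\<close> has no zeros and may
    be divided by. The same holds for \<open>q\<close>.\<close>
  have p_pos: "p m > 0" for m
  proof -
    have "poisson_mix p (a * real k) m > 0" using nk a p by (intro poisson_mix_pos) auto
    then have "p m * poisson_mix q (b * real m) k > 0" unfolding eq[where n = m and k = k, symmetric] using nk by simp
    then show ?thesis using p(1)[of m] by (metis less_eq_real_def mult_zero_left)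
  qed
  have q_pos: "q m > 0" for m
  proof -
    have "poisson_mix q (b * real n) m > 0" using nk ab q by (intro poisson_mix_pos) auto
    then have "poisson_mix p (a * real m) n * q m > 0" unfolding eq[where n = n and k = m] using nk by simp
    then show ?thesis using q(1)[of m] by (metis less_eq_real_def mult_zero_right)
  qed
  define x where "x = a * p 0 / p 1"
  define s where "s = p 1 ^ 2 / (p 0 * p 2)"
  define t where "t = q 1 ^ 2 / (q 0 * q 2)"
  define w where "w = q 1 ^ 3 / (q 0 ^ 2 * q 3)"
  have x: "x > 0" using a p_pos[of 0] p_pos[of 1] by (simp add: x_def)
  have e: "poisson_mix p (a * real k) n / p n = poisson_mix q (b * real n) k / q k" for n k
    using eq[where n = n and k = k] p_pos[of n] q_pos[of k] by (simp add: field_simps)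
  have "a = p 1 / p 0 * x" using p_pos[of 0] p_pos[of 1] by (simp add: x_def)
  then have a_eq: "a * real k = p 1 / p 0 * (x * real k)" for k by simp
  note p_norm = poisson_mix_normalized[OF p_pos[of 0] p_pos[of 1] p_pos[of 2] p_pos[of 3]]
  note q_norm = poisson_mix_normalized[OF q_pos[of 0] q_pos[of 1] q_pos[of 2] q_pos[of 3]]
  have p1: "poisson_mix p (a * real k) 1 / p 1 = 1 + x * real k" for k
    unfolding a_eq by (rule p_norm)
  have p2: "poisson_mix p (a * real k) 2 / p 2 = 1 + s * (x * real k + (x * real k) ^ 2 / 2)" for k
    unfolding a_eq s_def by (rule p_norm)
  \<comment> \<open>The point \<open>(1, 1)\<close> shows that \<open>b\<close> in the units of
    \<open>q\<close> is the same \<open>x\<close> as \<open>a\<close> in the units of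
    \<open>p\<close>.\<close>
  have "1 + x = (q 0 * b + q 1) / q 1"
    using e[where n = 1 and k = 1] unfolding p1 unfolding poisson_mix_1 by simp
  then have "b = q 1 / q 0 * x"
    using q_pos[of 0] q_pos[of 1] by (simp add: field_simps del: One_nat_def)
  then have b_eq: "b * real n = q 1 / q 0 * (x * real n)" for n by simp
  have q1: "poisson_mix q (b * real n) 1 / q 1 = 1 + x * real n" for n
    unfolding b_eq by (rule q_norm)
  have q2: "poisson_mix q (b * real n) 2 / q 2 = 1 + t * (x * real n + (x * real n) ^ 2 / 2)" for n
    unfolding b_eq t_def by (rule q_norm)
  have q3: "poisson_mix q (b * real n) 3 / q 3 =
      1 + w * (x * real n / t + (x * real n) ^ 2 / 2 + (x * real n) ^ 3 / 6)" for n
    unfolding b_eq t_def w_def by (rule q_norm)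
  have t0: "t > 0" using q_pos[of 0] q_pos[of 1] q_pos[of 2] by (simp add: t_def)
  have s1: "s * (2 + x) = 4"
  proof -
    have "s * (x + x^2/2) = 2 * x" using e[where n = 2 and k = 1] unfolding p2 q1 by simp
    then have "x * (s * (2 + x)) = x * 4" by (simp add: field_simps power2_eq_square)
    then show ?thesis using x by simp
  qed
  have t1: "t * (2 + x) = 4"
  proof -
    have "t * (x + x^2/2) = 2 * x" using e[where n = 1 and k = 2] unfolding p1 q2 by simp
    then have "x * (t * (2 + x)) = x * 4" by (simp add: field_simps power2_eq_square)
    then show ?thesis using x by simp
  qed
  then have t2: "1 / t = (2 + x) / 4" using t0 by (simp add: field_simps)
  have e13: "w * ((2 + x) / 4 + x / 2 + x^2 / 6) = 3"
  proof -
    have "w * (x / t + x^2 / 2 + x^3 / 6) = 3 * x" using e[where n = 1 and k = 3] unfolding p1 q3 by simp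
    moreover have "x / t = x * ((2 + x) / 4)" using t2 by (metis times_divide_eq_right mult_1_right)
    ultimately have "x * (w * ((2 + x) / 4 + x / 2 + x^2 / 6)) = x * 3"
      by (simp add: algebra_simps add_divide_distrib power2_eq_square power3_eq_cube)
    then show ?thesis using x by simp
  qed
  have e23: "w * ((2 + x) / 2 + 2 * x + 4 * x^2 / 3) = s * (3 + 9 * x / 2)"
  proof -
    have "w * (2 * (x / t) + (2 * x)^2 / 2 + (2 * x)^3 / 6) = s * (3 * x + (3 * x)^2 / 2)"
      using e[where n = 2 and k = 3] unfolding p2 q3 by (simp add: mult.commute)
    moreover have "x / t = x * ((2 + x) / 4)" using t2 by (metis times_divide_eq_right mult_1_right)
    ultimately have "x * (w * ((2 + x) / 2 + 2 * x + 4 * x^2 / 3)) = x * (s * (3 + 9 * x / 2))"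
      by (simp add: algebra_simps add_divide_distrib power2_eq_square power3_eq_cube)
    then show ?thesis using x by simp
  qed
  \<comment> \<open>Both \<open>e13\<close> and \<open>e23\<close> are linear in \<open>w\<close>;
    cross-multiplying eliminates it, and the factor \<open>2 + x\<close> removes \<open>s\<close>
    through \<open>s1\<close>.\<close>
  have "w * ((2 + x) / 4 + x / 2 + x^2 / 6) * ((2 + x) * ((2 + x) / 2 + 2 * x + 4 * x^2 / 3)) =
        (w * ((2 + x) / 2 + 2 * x + 4 * x^2 / 3)) * (2 + x) * ((2 + x) / 4 + x / 2 + x^2 / 6)"
    by (simp add: mult_ac)
  also have "\<dots> = (s * (2 + x)) * (3 + 9 * x / 2) * ((2 + x) / 4 + x / 2 + x^2 / 6)"
    unfolding e23 by (simp add: mult_ac)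
  finally have "3 * ((2 + x) * ((2 + x) / 2 + 2 * x + 4 * x^2 / 3)) =
      4 * (3 + 9 * x / 2) * ((2 + x) / 4 + x / 2 + x^2 / 6)"
    unfolding e13 s1 .
  \<comment> \<open>Both sides have the same terms up to degree two; their cubic terms are
    \<open>4 * x ^ 3\<close> and \<open>3 * x ^ 3\<close>.\<close>
  then have "x ^ 3 = 0" by (simp add: field_simps power2_eq_square power3_eq_cube)
  then show False using x by simp
qed

section \<open>Identifiability from the product formula\<close>

text \<open>The Markov factorization. Summing over all of \<open>V\<close> leaves the graph implicit
  in the support of \<open>a\<close>, so models with different graphs share one formula.\<close>

definition joint_mass :: "'v set \<Rightarrow> ('v \<Rightarrow> 'v \<Rightarrow> real) \<Rightarrow> ('v \<Rightarrow> nat \<Rightarrow> real) \<Rightarrow> ('v \<Rightarrow> nat) \<Rightarrow> real" where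
  "joint_mass V a p x = (\<Prod>v\<in>V. poisson_conv (p v) (\<Sum>j\<in>V. a v j * real (x j)) (x v))"

text \<open>The data of a regular PT-SEM without its probability space. An arbitrary finite
  \<open>V\<close> allows nodes to be removed in the induction; \<open>p_0\<close> renders (A1), and
  \<open>p_pos\<close> follows from (A2).\<close>

locale thinning_model =
  fixes V :: "'v set" and a :: "'v \<Rightarrow> 'v \<Rightarrow> real" and p :: "'v \<Rightarrow> nat \<Rightarrow> real"
  assumes finite_V: "finite V"
    and acyclic: "acyclic {(j, i). i \<in> V \<and> j \<in> V \<and> a i j > 0}"
    and a_nonneg: "\<And>i j. i \<in> V \<Longrightarrow> j \<in> V \<Longrightarrow> a i j \<ge> 0"
    and p_nonneg: "\<And>i n. i \<in> V \<Longrightarrow> p i n \<ge> 0"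
    and p_0: "\<And>i. i \<in> V \<Longrightarrow> p i 0 > 0"
    and p_pos: "\<And>i. i \<in> V \<Longrightarrow> \<exists>n>0. p i n > 0"
    and p_sums: "\<And>i. i \<in> V \<Longrightarrow> p i sums 1"
begin

section \<open>Sinks and their removal\<close>

lemma submodel:
  assumes "W \<subseteq> V"
  shows "thinning_model W a p"
proof -
  have "i \<in> V" if "i \<in> W" for i using assms that by blast
  then show ?thesis
    using finite_subset[OF assms finite_V]
    by unfold_locales
      (auto intro!: acyclic_subset[OF acyclic] a_nonneg p_nonneg p_0 p_pos p_sums)
qed

lemma no_two_cycle:
  assumes "i \<in> V" "j \<in> V" "a i j > 0"
  shows "a j i = 0"
proof (rule ccontr)
  let ?R = "{(j, i). i \<in> V \<and> j \<in> V \<and> a i j > 0}"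
  assume "a j i \<noteq> 0"
  with assms a_nonneg[of j i] have "(i, j) \<in> ?R" "(j, i) \<in> ?R" by auto
  then have "(i, i) \<in> ?R\<^sup>+" by (meson r_into_trancl' trancl_trans)
  with acyclic show False by (simp add: acyclic_def)
qed

lemma no_loop: "i \<in> V \<Longrightarrow> a i i = 0"
  using no_two_cycle[of i i] a_nonneg[of i i] by force

lemma exists_sink:
  assumes "V \<noteq> {}"
  obtains s where "s \<in> V" "\<forall>i\<in>V. a i s = 0"
proof -
  let ?R = "{(j, i). i \<in> V \<and> j \<in> V \<and> a i j > 0}"
  have "finite ?R"
    by (rule finite_subset[of _ "V \<times> V"]) (use finite_V in auto)
  then have "wf (?R\<inverse>)" using acyclic by (rule finite_acyclic_wf_converse)
  moreover obtain v where "v \<in> V" using assms by blast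
  ultimately obtain s where s: "s \<in> V" "\<And>y. (y, s) \<in> ?R\<inverse> \<Longrightarrow> y \<notin> V"
    by (rule wfE_min) blast
  have "a i s = 0" if "i \<in> V" for i
  proof (rule ccontr)
    assume "a i s \<noteq> 0"
    then have "(i, s) \<in> ?R\<inverse>" using that s(1) a_nonneg[of i s] by simp
    with s(2) that show False by blast
  qed
  with s(1) that show ?thesis by blast
qed

text \<open>No rate involves a sink, so its coordinate \<open>n\<close> occurs only in its own
  factor.\<close>

lemma joint_mass_sink:
  assumes s: "s \<in> V" "\<forall>i\<in>V. a i s = 0"
  shows "joint_mass V a p (x(s := n)) =
    poisson_conv (p s) (\<Sum>j\<in>V - {s}. a s j * real (x j)) n * joint_mass (V - {s}) a p x"
proof -
  have rate: "(\<Sum>j\<in>V. a v j * real ((x(s := n)) j)) = (\<Sum>j\<in>V - {s}. a v j * real (x j))"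
    if "v \<in> V" for v
    using finite_V s that by (simp add: sum.remove[of V s])
  show ?thesis
    using finite_V s(1) unfolding joint_mass_def
    by (simp add: prod.remove[of V s] rate del: fun_upd_apply) (simp add: Diff_iff)
qed

text \<open>Marginalizing the sink: its factor is a probability distribution in \<open>n\<close>,
  and the remaining product is constant in \<open>n\<close>.\<close>

lemma joint_mass_sums:
  assumes "s \<in> V" "\<forall>i\<in>V. a i s = 0"
  shows "(\<lambda>n. joint_mass V a p (x(s := n))) sums joint_mass (V - {s}) a p x"
proof -
  have "poisson_conv (p s) l sums 1" for l
    using assms(1) by (intro poisson_conv_sums p_sums p_nonneg)
  from sums_mult2[OF this] show ?thesis
    unfolding joint_mass_sink[OF assms] by simp
qed

section \<open>Masses at points with few nonzero coordinates\<close>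

lemma rate_single:
  assumes "c \<in> V" "W \<subseteq> V" "c \<in> W"
  shows "(\<Sum>j\<in>W. a v j * real (((\<lambda>_. 0)(c := k)) j)) = a v c * real k"
proof -
  have "finite W" using assms finite_V finite_subset by blast
  then show ?thesis using assms by (simp add: sum.remove[of W c])
qed

lemma joint_mass_0_pos: "W \<subseteq> V \<Longrightarrow> joint_mass W a p (\<lambda>_. 0) > 0"
  unfolding joint_mass_def by (intro prod_pos) (use p_0 in auto)

text \<open>Supplies points at which the law of a sink can be conditioned. Without loops the rate of
  \<open>c\<close> is zero there, and every other node takes the value 0 with positive
  probability.\<close>

lemma joint_mass_single_pos:
  assumes "W \<subseteq> V" "c \<in> W" "p c k > 0"
  shows "joint_mass W a p ((\<lambda>_. 0)(c := k)) > 0"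
proof -
  have "poisson_conv (p v) (a v c * real k) (((\<lambda>_. 0)(c := k)) v) > 0" if "v \<in> W" for v
    using assms that p_0[of v] no_loop[of c] by (cases "v = c") auto
  then show ?thesis
    unfolding joint_mass_def using assms
    by (intro prod_pos ballI) (subst rate_single, auto)
qed

text \<open>All nodes but \<open>s\<close> and \<open>c\<close> sit at 0, so their factors are
  constants times exponentials that split into a part in \<open>n\<close> and a part in
  \<open>k\<close>; only the effect \<open>c\<close> couples the two.\<close>

lemma joint_mass_cause_effect:
  assumes sc: "s \<in> V" "c \<in> V" "a c s > 0"
  obtains r t where "\<And>k. t k > 0"
    "\<And>n k. joint_mass V a p ((\<lambda>_. 0)(c := k, s := n)) =
      p s n * r n * poisson_mix (p c) (a c s * real n) k * t k"
proof
  let ?W = "V - {s} - {c}"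
  define r where "r n = exp (- (a c s * real n)) * (\<Prod>v\<in>?W. p v 0 * exp (- (a v s * real n)))" for n
  define t where "t k = (\<Prod>v\<in>?W. exp (- (a v c * real k)))" for k
  show "t k > 0" for k unfolding t_def by (intro prod_pos) auto
  fix n k :: nat
  let ?x = "(\<lambda>_. 0)(c := k, s := n)"
  have ne: "s \<noteq> c" using sc no_loop[of s] by auto
  \<comment> \<open>Since \<open>s\<close> causes \<open>c\<close>, acyclicity makes the rate of
    \<open>s\<close> zero and that of \<open>c\<close> independent of \<open>k\<close>.\<close>
  have loops: "a s c = 0" "a s s = 0" "a c c = 0"
    using sc no_loop no_two_cycle by auto
  have rate: "(\<Sum>j\<in>V. a v j * real (?x j)) = a v s * real n + a v c * real k" for v
    using sc ne finite_V by (simp add: sum.remove[of V s] sum.remove[of "V - {s}" c])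
  have "joint_mass V a p ?x = (\<Prod>v\<in>V. poisson_conv (p v) (a v s * real n + a v c * real k) (?x v))"
    unfolding joint_mass_def rate ..
  also have "\<dots> = p s n * (poisson_conv (p c) (a c s * real n) k *
      (\<Prod>v\<in>?W. exp (- (a v s * real n + a v c * real k)) * p v 0))"
    using sc ne finite_V loops by (simp add: prod.remove[of V s] prod.remove[of "V - {s}" c])
  also have "\<dots> = p s n * r n * poisson_mix (p c) (a c s * real n) k * t k"
    unfolding r_def t_def poisson_conv_def
    by (simp add: prod.distrib exp_add exp_diff exp_minus mult_ac divide_inverse flip: exp_minus)
  finally show "joint_mass V a p ?x = p s n * r n * poisson_mix (p c) (a c s * real n) k * t k" .
qed

end

section \<open>Comparison of two models\<close>

text \<open>The cross ratio of the values at \<open>(n, k)\<close>, \<open>(0, 0)\<close>,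
  \<open>(n, 0)\<close>, \<open>(0, k)\<close> does not see factors of one variable; it is written
  without division because \<open>p n\<close> and \<open>q k\<close> may vanish.\<close>

lemma factorization_normalize:
  fixes A B :: "nat \<Rightarrow> nat \<Rightarrow> real"
  assumes eq: "\<And>n k. A n k * R k = r n * B n k * t k"
    and A: "\<And>n. A n 0 = p n" "\<And>k. A 0 k = p 0"
    and B: "\<And>k. B 0 k = q k" "\<And>n. B n 0 = q 0"
    and pos: "p 0 > 0" "q 0 > 0" "\<And>k. t k > 0" "R 0 > 0"
  shows "A n k * q k = p n * B n k"
proof -
  have 1: "p 0 * R k = r 0 * q k * t k" using eq[of 0 k] A B by simp
  have 2: "p n * R 0 = r n * q 0 * t 0" using eq[of n 0] A B by simp
  have 3: "p 0 * R 0 = r 0 * q 0 * t 0" using eq[of 0 0] A B by simp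
  have r0: "r 0 \<noteq> 0" using 3 pos(1,2,4) pos(3)[of 0] by auto
  have "A n k * (r 0 * q k * t k) * (q 0 * t 0) = A n k * R k * p 0 * (q 0 * t 0)"
    unfolding 1[symmetric] by simp
  also have "\<dots> = (r n * q 0 * t 0) * B n k * t k * p 0"
    unfolding eq by simp
  also have "\<dots> = p n * B n k * t k * (p 0 * R 0)"
    unfolding 2[symmetric] by simp
  also have "\<dots> = p n * B n k * t k * (r 0 * q 0 * t 0)"
    unfolding 3 ..
  finally have "(A n k * q k) * (r 0 * t k * q 0 * t 0) = (p n * B n k) * (r 0 * t k * q 0 * t 0)"
    by (simp add: mult_ac)
  moreover have "r 0 * t k * q 0 * t 0 \<noteq> 0"
    using r0 pos(2) pos(3)[of k] pos(3)[of 0] by simp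
  ultimately show ?thesis by simp
qed

lemma sink_transfer:
  assumes m: "thinning_model V a p" and m': "thinning_model V a' p'"
    and eq: "\<And>x. joint_mass V a p x = joint_mass V a' p' x"
    and s: "s \<in> V" "\<forall>i\<in>V. a i s = 0"
    and c: "c \<in> V"
  shows "a' c s = 0"
proof (rule ccontr)
  interpret m: thinning_model V a p by fact
  interpret m': thinning_model V a' p' by fact
  assume "a' c s \<noteq> 0"
  then have pos: "a' c s > 0" using m'.a_nonneg[of c s] s c by simp
  then have ne: "c \<noteq> s" using m'.no_loop[of s] s by auto
  obtain r t where t: "\<And>k. t k > 0"
    and fac: "\<And>n k. joint_mass V a' p' ((\<lambda>_. 0)(c := k, s := n)) =
      p' s n * r n * poisson_mix (p' c) (a' c s * real n) k * t k"
    by (rule m'.joint_mass_cause_effect[OF s(1) c pos]) (rule that)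
  \<comment> \<open>\<open>R\<close> collects the part of the first model's mass that does not
    depend on the value \<open>n\<close> of its sink.\<close>
  define R where "R k = exp (- (a s c * real k)) * joint_mass (V - {s}) a p ((\<lambda>_. 0)(c := k))" for k
  have R0: "R 0 > 0"
    using m.joint_mass_0_pos[of "V - {s}"] by (auto simp: R_def fun_upd_idem)
  have "poisson_mix (p s) (a s c * real k) n * R k =
      (p' s n * r n) * poisson_mix (p' c) (a' c s * real n) k * t k" for n k
  proof -
    have "(\<Sum>j\<in>V - {s}. a s j * real (((\<lambda>_. 0)(c := k)) j)) = a s c * real k"
      using c ne by (intro m.rate_single) auto
    then have "joint_mass V a p ((\<lambda>_. 0)(c := k, s := n)) = poisson_mix (p s) (a s c * real k) n * R k"
      by (subst m.joint_mass_sink[OF s]) (simp_all add: R_def poisson_conv_def)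
    then show ?thesis unfolding eq fac by simp
  qed
  then have sym: "poisson_mix (p s) (a s c * real k) n * p' c k = p s n * poisson_mix (p' c) (a' c s * real n) k" for n k
    by (rule factorization_normalize) (use R0 t m.p_0[OF s(1)] m'.p_0[OF c] in simp_all)
  \<comment> \<open>In the first model \<open>c\<close> may or may not be a parent of
    \<open>s\<close>; both cases are excluded.\<close>
  have "a s c \<ge> 0" using m.a_nonneg s c by blast
  then show False
    by (rule no_two_way_factorization[OF
          m.p_nonneg[OF s(1)] m.p_0[OF s(1)] m.p_pos[OF s(1)] m'.p_nonneg[OF c] m'.p_0[OF c] m'.p_pos[OF c]
          _ pos sym])
qed

theorem joint_mass_identifiable:
  assumes "thinning_model V a p" "thinning_model V a' p'"
    and "\<And>x. joint_mass V a p x = joint_mass V a' p' x"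
    and "i \<in> V"
  shows "p i = p' i \<and> (\<forall>j\<in>V. a i j = a' i j)"
proof -
  have "finite V" using assms(1) by (rule thinning_model.finite_V)
  then show ?thesis using assms
  proof (induction V arbitrary: i rule: finite_psubset_induct)
    case (psubset V)
    interpret m: thinning_model V a p by fact
    interpret m': thinning_model V a' p' by fact
    from \<open>i \<in> V\<close> obtain s where s: "s \<in> V" "\<forall>i\<in>V. a i s = 0"
      using m.exists_sink by blast
    have s': "\<forall>i\<in>V. a' i s = 0"
      using sink_transfer[OF psubset.prems(1-3) s] by blast
    let ?W = "V - {s}"
    have W: "joint_mass ?W a p x = joint_mass ?W a' p' x" for x
      using m.joint_mass_sums[OF s, of x] m'.joint_mass_sums[OF s(1) s', of x]
      unfolding psubset.prems(3) by (rule sums_unique2)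
    have IH: "p v = p' v \<and> (\<forall>j\<in>?W. a v j = a' v j)" if "v \<in> ?W" for v
      using s(1) that W m.submodel m'.submodel by (intro psubset.IH) auto
    \<comment> \<open>Dividing by the positive mass of \<open>x\<close> on \<open>?W\<close>
      compares the conditional laws of \<open>s\<close>.\<close>
    have cond: "poisson_conv (p s) (\<Sum>j\<in>?W. a s j * real (x j)) n =
        poisson_conv (p' s) (\<Sum>j\<in>?W. a' s j * real (x j)) n"
      if "joint_mass ?W a p x > 0" for x n
      using psubset.prems(3)[of "x(s := n)"] that
      unfolding m.joint_mass_sink[OF s] m'.joint_mass_sink[OF s(1) s'] W by auto
    \<comment> \<open>At the origin all rates vanish, so the conditional law of \<open>s\<close> is
      its noise law.\<close>
    have p_s: "p s = p' s"
    proof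
      fix n
      show "p s n = p' s n" using cond[OF m.joint_mass_0_pos, of n] by auto
    qed
    have a_s: "a s j = a' s j" if j: "j \<in> ?W" for j
    proof -
      \<comment> \<open>The coefficient shows only at a value \<open>k > 0\<close> of positive mass;
        the conditional probability that \<open>s\<close> is 0 is then
        \<open>exp (- (a s j * real k)) * p s 0\<close>.\<close>
      obtain k where k: "k > 0" "p j k > 0" using m.p_pos[of j] j by auto
      have "poisson_conv (p s) (a s j * real k) 0 = poisson_conv (p' s) (a' s j * real k) 0"
        using cond[OF m.joint_mass_single_pos[of ?W j k], of 0] j k
          m.rate_single[of j ?W] m'.rate_single[of j ?W] by auto
      then show ?thesis using p_s m.p_0[OF s(1)] k by simp
    qed
    show ?case
      using IH p_s a_s s s' \<open>i \<in> V\<close> by (metis DiffI singletonD)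
  qed
qed

section \<open>The joint law of a PT-SEM\<close>

lemma measurable_sum_nat:
  fixes f :: "'i \<Rightarrow> 'a \<Rightarrow> nat"
  assumes "\<And>i. i \<in> I \<Longrightarrow> f i \<in> measurable M (count_space UNIV)"
  shows "(\<lambda>x. \<Sum>i\<in>I. f i x) \<in> measurable M (count_space UNIV)"
  using assms
proof (induction I rule: infinite_finite_induct)
  case (insert i I)
  have "(\<lambda>x. m + (\<Sum>i\<in>I. f i x)) \<in> measurable M (count_space UNIV)" for m
    by (rule measurable_compose[OF insert.IH]) (use insert in auto)
  then have "(\<lambda>x. f i x + (\<Sum>i\<in>I. f i x)) \<in> measurable M (count_space UNIV)"
    by (rule measurable_compose_countable) (use insert in auto)
  with insert show ?case by simp
qed simp_all

section \<open>Sums of independent counts\<close>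

context prob_space
begin

lemma prob_indep_add:
  fixes A B :: "'a \<Rightarrow> nat"
  assumes ind: "indep_var (count_space UNIV) A (count_space UNIV) B"
  shows "prob {\<omega> \<in> space M. A \<omega> + B \<omega> = n} =
    (\<Sum>m\<le>n. prob {\<omega> \<in> space M. A \<omega> = m} * prob {\<omega> \<in> space M. B \<omega> = n - m})"
proof -
  have [measurable]: "A \<in> measurable M (count_space UNIV)" "B \<in> measurable M (count_space UNIV)"
    using indep_var_rv1[OF ind] indep_var_rv2[OF ind] by auto
  let ?S = "\<lambda>m. {\<omega> \<in> space M. A \<omega> = m \<and> B \<omega> = n - m}"
  have S: "prob (?S m) = prob {\<omega> \<in> space M. A \<omega> = m} * prob {\<omega> \<in> space M. B \<omega> = n - m}" for m
    using indep_varD[OF ind, of "{m}" "{n - m}"]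
    by (simp add: vimage_def Int_def conj_commute)
  have "{\<omega> \<in> space M. A \<omega> + B \<omega> = n} = (\<Union>m\<in>{..n}. ?S m)" by auto
  also have "prob \<dots> = (\<Sum>m\<in>{..n}. prob (?S m))"
    by (rule finite_measure_finite_Union) (auto simp: disjoint_family_on_def)
  finally show ?thesis unfolding S .
qed

lemma indep_vars_sum_nat:
  fixes W :: "'i \<Rightarrow> 'a \<Rightarrow> nat"
  assumes "finite I" "i \<notin> I" "indep_vars (\<lambda>_. count_space UNIV) W (insert i I)"
  shows "indep_var (count_space UNIV) (\<lambda>\<omega>. \<Sum>i\<in>I. W i \<omega>) (count_space UNIV) (W i)"
proof -
  have "indep_var
      (count_space UNIV) ((\<lambda>f. \<Sum>i\<in>I. f i) \<circ> (\<lambda>\<omega>. restrict (\<lambda>i. W i \<omega>) I))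
      (count_space UNIV) ((\<lambda>f. f i) \<circ> (\<lambda>\<omega>. restrict (\<lambda>i. W i \<omega>) {i}))"
    using assms
    by (intro indep_var_compose[OF indep_var_restrict[OF assms(3)]] measurable_sum_nat) auto
  then show ?thesis by (simp add: comp_def)
qed

text \<open>The Poisson variables join the noise \<open>W c\<close> one at a time; each adds its
  rate by \<open>poisson_conv_add\<close>.\<close>

lemma prob_sum_poisson:
  fixes W :: "'i \<Rightarrow> 'a \<Rightarrow> nat"
  assumes "finite S" "c \<notin> S" "indep_vars (\<lambda>_. count_space UNIV) W (insert c S)"
    and "\<And>s. s \<in> S \<Longrightarrow> r s > 0"
    and "\<And>s. s \<in> S \<Longrightarrow> distr M (count_space UNIV) (W s) = measure_pmf (poisson_pmf (r s))"
  shows "prob {\<omega> \<in> space M. (\<Sum>i\<in>insert c S. W i \<omega>) = n} =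
    poisson_conv (\<lambda>n. prob {\<omega> \<in> space M. W c \<omega> = n}) (\<Sum>s\<in>S. r s) n"
  using assms
proof (induction S arbitrary: n)
  case empty
  then show ?case by simp
next
  case (insert s S)
  let ?p = "\<lambda>n. prob {\<omega> \<in> space M. W c \<omega> = n}"
  have ins: "insert c (insert s S) = insert s (insert c S)" by auto
  have s: "s \<notin> insert c S" using insert by auto
  have ind: "indep_vars (\<lambda>_. count_space UNIV) W (insert c S)"
    by (rule indep_vars_subset[OF insert.prems(2)]) auto
  have W [measurable]: "W s \<in> measurable M (count_space UNIV)"
    using insert.prems(2) by (auto simp: indep_vars_def)
  have poi: "prob {\<omega> \<in> space M. W s \<omega> = k} = exp (- r s) * (r s ^ k / fact k)" for k
  proof -
    have "prob {\<omega> \<in> space M. W s \<omega> = k} = measure (distr M (count_space UNIV) (W s)) {k}"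
      by (subst measure_distr) (auto intro!: arg_cong[where f = prob])
    also have "\<dots> = pmf (poisson_pmf (r s)) k"
      using insert.prems(4)[of s] by (simp add: pmf.rep_eq)
    finally show ?thesis using insert.prems(3)[of s] by simp
  qed
  have "prob {\<omega> \<in> space M. (\<Sum>i\<in>insert c (insert s S). W i \<omega>) = n} =
      prob {\<omega> \<in> space M. (\<Sum>i\<in>insert c S. W i \<omega>) + W s \<omega> = n}"
    unfolding ins using s insert.hyps(1) by (simp add: add.commute)
  also have "\<dots> = (\<Sum>m\<le>n. prob {\<omega> \<in> space M. (\<Sum>i\<in>insert c S. W i \<omega>) = m} *
      prob {\<omega> \<in> space M. W s \<omega> = n - m})"
    using insert.hyps(1) s insert.prems(2) unfolding ins
    by (intro prob_indep_add indep_vars_sum_nat) auto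
  also have "\<dots> = (\<Sum>m\<le>n. poisson_conv ?p (\<Sum>s\<in>S. r s) m * (exp (- r s) * (r s ^ (n - m) / fact (n - m))))"
    unfolding poi using insert.prems ind by (intro sum.cong refl arg_cong2[of _ _ _ _ "(*)"] insert.IH) auto
  also have "\<dots> = poisson_conv (poisson_conv ?p (\<Sum>s\<in>S. r s)) (r s) n"
    unfolding poisson_conv_def[of "poisson_conv ?p (\<Sum>s\<in>S. r s)"] poisson_mix_def[of "poisson_conv ?p (\<Sum>s\<in>S. r s)"]
    by (simp add: sum_distrib_left mult_ac)
  also have "\<dots> = poisson_conv ?p (\<Sum>s\<in>insert s S. r s) n"
    using insert.hyps by (simp add: poisson_conv_add add.commute)
  finally show ?case .
qed

end

section \<open>The structural equations with frozen parent values\<close>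

context pt_sem
begin

definition noise_mass :: "nat \<Rightarrow> nat \<Rightarrow> real" where
  "noise_mass i n = prob {\<omega> \<in> space M. \<epsilon> i \<omega> = n}"

abbreviation noise_family :: "nat + nat \<times> nat \<times> nat \<Rightarrow> 'a \<Rightarrow> nat" where
  "noise_family \<equiv> case_sum \<epsilon> (\<lambda>(i, j, l). Z i j l)"

text \<open>Offspring used by node \<open>i\<close> when the parents have the fixed values
  \<open>x\<close>. The child stays in the index, which makes the blocks of different nodes
  disjoint.\<close>

definition block :: "(nat \<Rightarrow> nat) \<Rightarrow> nat \<Rightarrow> (nat \<times> nat \<times> nat) set" where
  "block x i = (\<lambda>(j, l). (i, j, l)) ` (SIGMA j:parents E i. {1..x j})"

lemma parents_subset: "parents E i \<subseteq> {1..d}"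
  using edges by (auto simp: parents_def)

lemma finite_parents: "finite (parents E i)"
  using parents_subset finite_subset by blast

lemma finite_block: "finite (block x i)"
  by (auto simp: block_def finite_parents)

lemma sum_block: "(\<Sum>k\<in>block x i. f k) = (\<Sum>j\<in>parents E i. \<Sum>l=1..x j. f (i, j, l))"
  unfolding block_def
  by (subst sum.reindex) (auto simp: inj_on_def sum.Sigma finite_parents)

lemma measurable_noise:
  assumes "i \<in> {1..d}"
  shows "\<epsilon> i \<in> measurable M (count_space UNIV)"
proof -
  have "noise_family (Inl i) \<in> measurable M (count_space UNIV)"
    using indep assms unfolding indep_vars_def by blast
  then show ?thesis by simp
qed

text \<open>The structural equation with frozen parents, written as one sum over an index set so
  that independence of groups applies directly.\<close>

definition local_sum :: "(nat \<Rightarrow> nat) \<Rightarrow> nat \<Rightarrow> 'a \<Rightarrow> nat" where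
  "local_sum x i \<omega> = (\<Sum>k\<in>insert (Inl i) (Inr ` block x i). noise_family k \<omega>)"

lemma local_sum_eq:
  "local_sum x i \<omega> = (\<Sum>j\<in>parents E i. \<Sum>l=1..x j. Z i j l \<omega>) + \<epsilon> i \<omega>"
proof -
  have "(\<Sum>k\<in>Inr ` block x i. noise_family k \<omega>) = (\<Sum>k\<in>block x i. (case k of (i, j, l) \<Rightarrow> Z i j l) \<omega>)"
    by (subst sum.reindex) (auto simp: inj_on_def)
  then show ?thesis
    unfolding local_sum_def using finite_block by (subst sum.insert) (auto simp: sum_block)
qed

lemma block_index:
  "i \<in> {1..d} \<Longrightarrow> insert (Inl i) (Inr ` block x i) \<subseteq> {1..d} <+> {(i, j, l). (j, i) \<in> E \<and> 1 \<le> l}"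
  by (auto simp: block_def parents_def)

lemma prob_local_sum:
  assumes i: "i \<in> {1..d}"
  shows "prob {\<omega> \<in> space M. local_sum x i \<omega> = n} =
    poisson_conv (noise_mass i) (\<Sum>j\<in>{1..d}. \<alpha> i j * real (x j)) n"
proof -
  \<comment> \<open>The value 0 at \<open>Inl\<close> is a dummy: the rates are summed over
    offspring indices only.\<close>
  define r :: "nat + nat \<times> nat \<times> nat \<Rightarrow> real" where "r = case_sum (\<lambda>_. 0) (\<lambda>(i, j, l). \<alpha> i j)"
  have "prob {\<omega> \<in> space M. local_sum x i \<omega> = n} =
      poisson_conv (\<lambda>n. prob {\<omega> \<in> space M. noise_family (Inl i) \<omega> = n}) (\<Sum>s\<in>Inr ` block x i. r s) n"
    unfolding local_sum_def
    using finite_block coeff_pos offspring indep_vars_subset[OF indep block_index[OF i]]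
    by (intro prob_sum_poisson) (auto simp: block_def parents_def r_def)
  also have "(\<Sum>s\<in>Inr ` block x i. r s) = (\<Sum>k\<in>block x i. r (Inr k))"
    by (subst sum.reindex) (auto simp: inj_on_def)
  also have "\<dots> = (\<Sum>j\<in>parents E i. \<alpha> i j * real (x j))"
    by (simp add: sum_block r_def mult.commute)
  also have "\<dots> = (\<Sum>j\<in>{1..d}. \<alpha> i j * real (x j))"
    by (rule sum.mono_neutral_left) (use parents_subset coeff_zero i in \<open>auto simp: parents_def\<close>)
  finally show ?thesis by (simp add: noise_mass_def[abs_def])
qed

text \<open>Different nodes draw on disjoint groups of one independent family.\<close>

lemma indep_local_sum: "indep_vars (\<lambda>_. count_space UNIV) (local_sum x) {1..d}"
proof -
  let ?K = "\<lambda>i. insert (Inl i) (Inr ` block x i)"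
  have "indep_vars (\<lambda>i. PiM (?K i) (\<lambda>_. count_space UNIV))
      (\<lambda>i \<omega>. restrict (\<lambda>k. noise_family k \<omega>) (?K i)) {1..d}"
    by (rule indep_vars_restrict[OF indep block_index])
       (auto simp: disjoint_family_on_def block_def)
  then have "indep_vars (\<lambda>_. count_space UNIV)
      (\<lambda>i \<omega>. \<Sum>k\<in>?K i. restrict (\<lambda>k. noise_family k \<omega>) (?K i) k) {1..d}"
    by (rule indep_vars_compose2) (intro measurable_sum_nat measurable_component_singleton)
  moreover have "(\<Sum>k\<in>?K i. restrict (\<lambda>k. noise_family k \<omega>) (?K i) k) = local_sum x i \<omega>" for i \<omega>
    unfolding local_sum_def by (intro sum.cong) auto
  ultimately show ?thesis by simp
qed

text \<open>Acyclicity makes the solution of the structural equations unique.\<close>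

lemma all_eq_iff_local_sum:
  assumes eq: "\<And>i. i \<in> {1..d} \<Longrightarrow> X i \<omega> = (\<Sum>j\<in>parents E i. thinning (Z i j) (X j) \<omega>) + \<epsilon> i \<omega>"
  shows "(\<forall>i\<in>{1..d}. X i \<omega> = x i) \<longleftrightarrow> (\<forall>i\<in>{1..d}. local_sum x i \<omega> = x i)"
proof -
  \<comment> \<open>Once the parents of \<open>i\<close> have the values \<open>x\<close>, the
    random sums have the lengths used in \<open>local_sum x i\<close>.\<close>
  have step: "X i \<omega> = local_sum x i \<omega>" if "i \<in> {1..d}" "\<And>j. j \<in> parents E i \<Longrightarrow> X j \<omega> = x j" for i
    using that by (simp add: eq local_sum_eq thinning_def cong: sum.cong)
  have "X i \<omega> = x i" if loc: "\<forall>i\<in>{1..d}. local_sum x i \<omega> = x i" and "i \<in> {1..d}" for i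
  proof -
    have "finite E" using edges finite_subset by blast
    then have "wf E" using dag by (rule finite_acyclic_wf)
    then show ?thesis using \<open>i \<in> {1..d}\<close>
    proof (induction i rule: wf_induct_rule)
      case (less i)
      have "X j \<omega> = x j" if "j \<in> parents E i" for j
        using that parents_subset[of i] less.IH[of j] by (auto simp: parents_def)
      with step[OF less.prems] loc less.prems show ?case by simp
    qed
  qed
  moreover have "local_sum x i \<omega> = x i" if all: "\<forall>i\<in>{1..d}. X i \<omega> = x i" and "i \<in> {1..d}" for i
  proof -
    have "X j \<omega> = x j" if "j \<in> parents E i" for j
      using that parents_subset all by blast
    with step[OF \<open>i \<in> {1..d}\<close>] all \<open>i \<in> {1..d}\<close> show ?thesis by simp
  qed
  ultimately show ?thesis by blast
qed

text \<open>Almost surely the event is that every \<open>local_sum x i\<close> equals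
  \<open>x i\<close>. The dependent random sums are thus replaced by sums of fixed length, which are
  independent across nodes.\<close>

lemma prob_eq_joint_mass:
  "prob {\<omega> \<in> space M. \<forall>i\<in>{1..d}. X i \<omega> = x i} = joint_mass {1..d} \<alpha> noise_mass x"
proof -
  note [measurable] = X_measurable
  have [measurable]: "local_sum x i \<in> measurable M (count_space UNIV)" if "i \<in> {1..d}" for i
    using indep_local_sum that by (auto simp: indep_vars_def)
  have "AE \<omega> in M. \<forall>i\<in>{1..d}. X i \<omega> = (\<Sum>j\<in>parents E i. thinning (Z i j) (X j) \<omega>) + \<epsilon> i \<omega>"
    by (rule AE_finite_allI) (use structural_eq in auto)
  then have "AE \<omega> in M. (\<forall>i\<in>{1..d}. X i \<omega> = x i) \<longleftrightarrow> (\<forall>i\<in>{1..d}. local_sum x i \<omega> = x i)"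
    by eventually_elim (rule all_eq_iff_local_sum, auto)
  then have "prob {\<omega> \<in> space M. \<forall>i\<in>{1..d}. X i \<omega> = x i} =
      prob {\<omega> \<in> space M. \<forall>i\<in>{1..d}. local_sum x i \<omega> = x i}"
    by (intro finite_measure_eq_AE) auto
  also have "\<dots> = (\<Prod>i\<in>{1..d}. prob {\<omega> \<in> space M. local_sum x i \<omega> = x i})"
  \<comment> \<open>For \<open>d = 0\<close> the intersection over all nodes would be
    \<open>UNIV\<close> instead of the sample space.\<close>
  proof (cases "d = 0")
    case True
    then show ?thesis by (simp add: prob_space)
  next
    case False
    have "{\<omega> \<in> space M. \<forall>i\<in>{1..d}. local_sum x i \<omega> = x i} = (\<Inter>i\<in>{1..d}. local_sum x i -` {x i} \<inter> space M)"
      using False by auto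
    also have "prob \<dots> = (\<Prod>i\<in>{1..d}. prob (local_sum x i -` {x i} \<inter> space M))"
      using False by (intro indep_varsD_finite[OF indep_local_sum]) auto
    also have "\<dots> = (\<Prod>i\<in>{1..d}. prob {\<omega> \<in> space M. local_sum x i \<omega> = x i})"
      by (intro prod.cong refl arg_cong[where f = prob]) auto
    finally show ?thesis .
  qed
  also have "\<dots> = joint_mass {1..d} \<alpha> noise_mass x"
    unfolding joint_mass_def by (intro prod.cong refl prob_local_sum) auto
  finally show ?thesis .
qed

lemma observational_distribution_eq_joint_mass:
  "measure (observational_distribution M d X) (PiE {1..d} (\<lambda>i. {x i})) =
    joint_mass {1..d} \<alpha> noise_mass x"
proof -
  have "measure (observational_distribution M d X) (PiE {1..d} (\<lambda>i. {x i})) =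
      prob ((\<lambda>\<omega>. \<lambda>i\<in>{1..d}. X i \<omega>) -` PiE {1..d} (\<lambda>i. {x i}) \<inter> space M)"
    unfolding observational_distribution_def
    using X_measurable by (intro measure_distr measurable_restrict sets_PiM_I_finite) auto
  also have "\<dots> = prob {\<omega> \<in> space M. \<forall>i\<in>{1..d}. X i \<omega> = x i}"
    by (intro arg_cong[where f = prob]) (auto simp: PiE_iff)
  finally show ?thesis unfolding prob_eq_joint_mass .
qed

lemma noise_mass_sums:
  assumes i: "i \<in> {1..d}"
  shows "noise_mass i sums 1"
proof -
  note [measurable] = measurable_noise[OF i]
  have "(\<lambda>n. prob {\<omega> \<in> space M. \<epsilon> i \<omega> = n}) sums prob (\<Union>n. {\<omega> \<in> space M. \<epsilon> i \<omega> = n})"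
    by (rule finite_measure_UNION) (auto simp: disjoint_family_on_def)
  also have "(\<Union>n. {\<omega> \<in> space M. \<epsilon> i \<omega> = n}) = space M" by auto
  finally show ?thesis by (simp add: noise_mass_def[abs_def] prob_space)
qed

lemma edge_iff: "i \<in> {1..d} \<Longrightarrow> j \<in> {1..d} \<Longrightarrow> (j, i) \<in> E \<longleftrightarrow> \<alpha> i j > 0"
  using coeff_pos coeff_zero by force

end

section \<open>Regular models as thinning models\<close>

context regular_pt_sem
begin

text \<open>Noise that is almost surely zero has variance zero, against (A2).\<close>

lemma noise_mass_pos:
  assumes i: "i \<in> {1..d}"
  shows "\<exists>n>0. noise_mass i n > 0"
proof (rule ccontr)
  note [measurable] = measurable_noise[OF i]
  assume "\<not> ?thesis"
  then have "noise_mass i n = 0" if "n > 0" for n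
    using that by (metis less_eq_real_def measure_nonneg noise_mass_def)
  then have "AE \<omega> in M. \<epsilon> i \<omega> \<noteq> n" if "n > 0" for n
    using that by (subst AE_iff_measurable[OF _ refl]) (auto simp: noise_mass_def emeasure_eq_measure)
  then have "AE \<omega> in M. \<forall>n. n > 0 \<longrightarrow> \<epsilon> i \<omega> \<noteq> n"
    by (subst AE_all_countable) auto
  then have zero: "AE \<omega> in M. real (\<epsilon> i \<omega>) = 0"
    by eventually_elim auto
  have e: "expectation (\<lambda>\<omega>. real (\<epsilon> i \<omega>)) = 0"
    by (rule integral_eq_zero_AE) (rule zero)
  have "variance (\<lambda>\<omega>. real (\<epsilon> i \<omega>)) = 0"
    unfolding e by (rule integral_eq_zero_AE) (use zero in eventually_elim, simp)
  with A2[OF i] show False by simp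
qed

lemma thinning_model: "thinning_model {1..d} \<alpha> noise_mass"
proof
  have "{(j, i). i \<in> {1..d} \<and> j \<in> {1..d} \<and> \<alpha> i j > 0} \<subseteq> E"
    using edge_iff by auto
  then show "acyclic {(j, i). i \<in> {1..d} \<and> j \<in> {1..d} \<and> \<alpha> i j > 0}"
    by (rule acyclic_subset[OF dag])
  show "\<alpha> i j \<ge> 0" if "i \<in> {1..d}" "j \<in> {1..d}" for i j
    using coeff_pos[of j i] coeff_zero[OF that] by (cases "(j, i) \<in> E") auto
qed (use A1 noise_mass_pos noise_mass_sums in \<open>auto simp: noise_mass_def\<close>)

end

section \<open>Recovery of the graph, the coefficients and the noise laws\<close>

lemma distr_eq_noise_mass:
  assumes "pt_sem M d E \<alpha> \<epsilon> Z X" "pt_sem M' d' E' \<alpha>' \<epsilon>' Z' X'" "i \<in> {1..d}" "i' \<in> {1..d'}"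
    and eq: "pt_sem.noise_mass M \<epsilon> i = pt_sem.noise_mass M' \<epsilon>' i'"
  shows "distr M (count_space UNIV) (\<epsilon> i) = distr M' (count_space UNIV) (\<epsilon>' i')"
proof (rule measure_eqI_countable[of _ UNIV])
  interpret m: pt_sem M d E \<alpha> \<epsilon> Z X by fact
  interpret m': pt_sem M' d' E' \<alpha>' \<epsilon>' Z' X' by fact
  fix n :: nat
  have "emeasure (distr M (count_space UNIV) (\<epsilon> i)) {n} = ennreal (m.noise_mass i n)"
    using m.measurable_noise[OF assms(3)]
    by (subst emeasure_distr) (auto simp: m.noise_mass_def m.emeasure_eq_measure intro!: arg_cong[where f = m.prob])
  moreover have "emeasure (distr M' (count_space UNIV) (\<epsilon>' i')) {n} = ennreal (m'.noise_mass i' n)"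
    using m'.measurable_noise[OF assms(4)]
    by (subst emeasure_distr) (auto simp: m'.noise_mass_def m'.emeasure_eq_measure intro!: arg_cong[where f = m'.prob])
  ultimately show "emeasure (distr M (count_space UNIV) (\<epsilon> i)) {n} =
      emeasure (distr M' (count_space UNIV) (\<epsilon>' i')) {n}"
    using eq by simp
qed auto

theorem theorem12:
  fixes M :: "'a measure" and M' :: "'b measure"
    and d :: nat
    and E E' :: "(nat \<times> nat) set"
    and \<alpha> \<alpha>' :: "nat \<Rightarrow> nat \<Rightarrow> real"
    and \<epsilon> :: "nat \<Rightarrow> 'a \<Rightarrow> nat" and \<epsilon>' :: "nat \<Rightarrow> 'b \<Rightarrow> nat"
    and Z :: "nat \<Rightarrow> nat \<Rightarrow> nat \<Rightarrow> 'a \<Rightarrow> nat" and Z' :: "nat \<Rightarrow> nat \<Rightarrow> nat \<Rightarrow> 'b \<Rightarrow> nat"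
    and X :: "nat \<Rightarrow> 'a \<Rightarrow> nat" and X' :: "nat \<Rightarrow> 'b \<Rightarrow> nat"
  assumes "regular_pt_sem M d E \<alpha> \<epsilon> Z X"
    and "regular_pt_sem M' d E' \<alpha>' \<epsilon>' Z' X'"
    and "observational_distribution M d X = observational_distribution M' d X'"
  shows "E = E'
    \<and> (\<forall>i\<in>{1..d}. \<forall>j\<in>{1..d}. \<alpha> i j = \<alpha>' i j)
    \<and> (\<forall>i\<in>{1..d}. distr M (count_space UNIV) (\<epsilon> i) = distr M' (count_space UNIV) (\<epsilon>' i))"
proof -
  interpret m: regular_pt_sem M d E \<alpha> \<epsilon> Z X by fact
  interpret m': regular_pt_sem M' d E' \<alpha>' \<epsilon>' Z' X' by fact
  have "joint_mass {1..d} \<alpha> m.noise_mass x = joint_mass {1..d} \<alpha>' m'.noise_mass x" for x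
    using m.observational_distribution_eq_joint_mass[of x]
      m'.observational_distribution_eq_joint_mass[of x] assms(3) by simp
  then have id: "m.noise_mass i = m'.noise_mass i \<and> (\<forall>j\<in>{1..d}. \<alpha> i j = \<alpha>' i j)" if "i \<in> {1..d}" for i
    using joint_mass_identifiable[OF m.thinning_model m'.thinning_model] that by blast
  \<comment> \<open>Both edge sets lie in the square of the vertex set, where an edge is the same as
    a positive coefficient.\<close>
  have "(j, i) \<in> E \<longleftrightarrow> (j, i) \<in> E'" for i j
    using m.edge_iff[of i j] m'.edge_iff[of i j] id[of i] m.edges m'.edges by auto
  then have "E = E'" by auto
  moreover have "distr M (count_space UNIV) (\<epsilon> i) = distr M' (count_space UNIV) (\<epsilon>' i)"
    if "i \<in> {1..d}" for i
    using id[OF that] that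
    by (intro distr_eq_noise_mass[OF m.pt_sem_axioms m'.pt_sem_axioms]) auto
  ultimately show ?thesis using id by blast
qed

end
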